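(* Let $f: \mathbb{R} \rightarrow \mathbb{R}$ be a function. The following conditions are equivalent: (1) For any $G_\delta$ set $C \subseteq \mathbb{R}$, $f^{-1}(C)$ is a $G_{\delta\sigma}$ set. (2) For any $G_{\delta\sigma}$ set $C \subseteq \mathbb{R}$, $f^{-1}(C)$ is a $G_{\delta\sigma}$ set. (3) The operator $T_f: g \mapsto g \circ f$ maps the space $\mathcal{B}_2(\mathbb{R})$ into itself (that is, $f$ is a right Baire two compositor).
   Context: A $G_\delta$ set is a countable intersection of open sets; a $G_{\delta\sigma}$ set is a countable union of $G_\delta$ sets. A function $\mathbb{R} \to \mathbb{R}$ is of Baire class one if it is the pointwise limit of a sequence of continuous functions $\mathbb{R}\to\mathbb{R}$, and of Baire class two if it is the pointwise limit of a sequence of functions of Baire class one; $\mathcal{B}_2(\mathbb{R})$ is the set of functions $\mathbb{R}\to\mathbb{R}$ of Baire class two. *)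

theory Defs
  imports "HOL-Analysis.Analysis"
begin

text \<open>The countable families are indexed by \<open>\<nat>\<close>. Since \<open>gdelta {}\<close> holds, this also covers
  finite and empty unions.\<close>

definition gdelta_sigma :: "'a::topological_space set \<Rightarrow> bool" where
  "gdelta_sigma S \<longleftrightarrow> (\<exists>A :: nat \<Rightarrow> 'a set. (\<forall>n. gdelta (A n)) \<and> S = (\<Union>n. A n))"

definition baire_one :: "(real \<Rightarrow> real) set" where
  "baire_one = {g. \<exists>h :: nat \<Rightarrow> real \<Rightarrow> real.
     (\<forall>n. continuous_on UNIV (h n)) \<and> (\<forall>x. (\<lambda>n. h n x) \<longlonglongrightarrow> g x)}"

definition baire_two :: "(real \<Rightarrow> real) set" where
  "baire_two = {g. \<exists>h :: nat \<Rightarrow> real \<Rightarrow> real.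
     (\<forall>n. h n \<in> baire_one) \<and> (\<forall>x. (\<lambda>n. h n x) \<longlonglongrightarrow> g x)}"

definition composition_operator :: "(real \<Rightarrow> real) \<Rightarrow> (real \<Rightarrow> real) \<Rightarrow> (real \<Rightarrow> real)" where
  "composition_operator f = (\<lambda>g. g \<circ> f)"

definition right_baire_two_compositor :: "(real \<Rightarrow> real) \<Rightarrow> bool" where
  "right_baire_two_compositor f \<longleftrightarrow> composition_operator f ` baire_two \<subseteq> baire_two"

end

theory Submission
  imports Defs
begin

text \<open>
  The compositor condition is reduced to level sets by the Lebesgue--Hausdorff characterisation:
  \<open>g\<close> is of Baire class two iff all sets \<open>{x. g x > a}\<close> and \<open>{x. g x < a}\<close> are \<open>G\<^sub>\<delta>\<^sub>\<sigma>\<close>.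
  For the hard direction, every \<open>G\<^sub>\<delta>\<close> set is the zero set of a nonnegative Baire one function, so
  two disjoint \<open>G\<^sub>\<delta>\<close> sets, being zero sets of \<open>z\<close> and \<open>w\<close>, are separated by the Baire one function
  \<open>w / (w + z)\<close>. Exhausting \<open>{g > q}\<close> and \<open>{g < q}\<close> by \<open>G\<^sub>\<delta>\<close> sets for rational \<open>q\<close>, the separating
  functions for finitely many \<open>q\<close> determine an approximation of \<open>g\<close> whose value is squeezed
  between any two rationals around \<open>g x\<close> from some stage on.
  Conversely, the indicator of a \<open>G\<^sub>\<delta>\<close> set is of Baire class two, which turns the compositor
  condition back into a statement about preimages.
\<close>

subsection \<open>Stability of Baire class one\<close>

lemma baire_oneI:
  assumes "\<And>n. continuous_on UNIV (h n)" "\<And>x. (\<lambda>n. h n x) \<longlonglongrightarrow> g x"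
  shows "g \<in> baire_one"
  using assms unfolding baire_one_def by blast

lemma baire_oneE:
  assumes "g \<in> baire_one"
  obtains h :: "nat \<Rightarrow> real \<Rightarrow> real"
  where "\<And>n. continuous_on UNIV (h n)" "\<And>x. (\<lambda>n. h n x) \<longlonglongrightarrow> g x"
  using assms unfolding baire_one_def by blast

lemma baire_twoI:
  assumes "\<And>n. h n \<in> baire_one" "\<And>x. (\<lambda>n. h n x) \<longlonglongrightarrow> g x"
  shows "g \<in> baire_two"
  using assms unfolding baire_two_def by blast

lemma baire_twoE:
  assumes "g \<in> baire_two"
  obtains h where "\<And>n. h n \<in> baire_one" "\<And>x. (\<lambda>n. h n x) \<longlonglongrightarrow> g x"
  using assms unfolding baire_two_def by blast

text \<open>Continuity of \<open>\<phi>\<close> on the plane both keeps the composed approximants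
  continuous and carries the limit through. This one fact yields closure under sums, differences,
  products and maxima.\<close>

lemma baire_one_compose2:
  fixes \<phi> :: "real \<times> real \<Rightarrow> real"
  assumes "g \<in> baire_one" "g' \<in> baire_one" and \<phi>: "continuous_on UNIV \<phi>"
  shows "(\<lambda>x. \<phi> (g x, g' x)) \<in> baire_one"
proof -
  obtain h where h: "\<And>n. continuous_on UNIV (h n)" "\<And>x. (\<lambda>n. h n x) \<longlonglongrightarrow> g x"
    using assms(1) by (rule baire_oneE) blast
  obtain h' where h': "\<And>n. continuous_on UNIV (h' n)" "\<And>x. (\<lambda>n. h' n x) \<longlonglongrightarrow> g' x"
    using assms(2) by (rule baire_oneE) blast
  show ?thesis
  proof (rule baire_oneI)
    show "continuous_on UNIV (\<lambda>x. \<phi> (h n x, h' n x))" for n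
      by (rule continuous_on_compose2 [OF \<phi>]) (auto intro!: continuous_intros h h')
    show "(\<lambda>n. \<phi> (h n x, h' n x)) \<longlonglongrightarrow> \<phi> (g x, g' x)" for x
    proof (rule isCont_tendsto_compose [where g = \<phi>])
      show "isCont \<phi> (g x, g' x)"
        using \<phi> by (simp add: continuous_on_eq_continuous_at)
      show "(\<lambda>n. (h n x, h' n x)) \<longlonglongrightarrow> (g x, g' x)"
        by (intro tendsto_Pair h h')
    qed
  qed
qed

lemma baire_one_const: "(\<lambda>x. c) \<in> baire_one"
  by (rule baire_oneI [where h = "\<lambda>n x. c"]) auto

lemma baire_one_add:
  "g \<in> baire_one \<Longrightarrow> g' \<in> baire_one \<Longrightarrow> (\<lambda>x. g x + g' x) \<in> baire_one"
  by (rule baire_one_compose2 [where \<phi> = "\<lambda>p. fst p + snd p", unfolded fst_conv snd_conv])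
    (auto intro!: continuous_intros)

lemma baire_one_diff:
  "g \<in> baire_one \<Longrightarrow> g' \<in> baire_one \<Longrightarrow> (\<lambda>x. g x - g' x) \<in> baire_one"
  by (rule baire_one_compose2 [where \<phi> = "\<lambda>p. fst p - snd p", unfolded fst_conv snd_conv])
    (auto intro!: continuous_intros)

lemma baire_one_mult:
  "g \<in> baire_one \<Longrightarrow> g' \<in> baire_one \<Longrightarrow> (\<lambda>x. g x * g' x) \<in> baire_one"
  by (rule baire_one_compose2 [where \<phi> = "\<lambda>p. fst p * snd p", unfolded fst_conv snd_conv])
    (auto intro!: continuous_intros)

lemma baire_one_max:
  "g \<in> baire_one \<Longrightarrow> g' \<in> baire_one \<Longrightarrow> (\<lambda>x. max (g x) (g' x)) \<in> baire_one"
  by (rule baire_one_compose2 [where \<phi> = "\<lambda>p. max (fst p) (snd p)", unfolded fst_conv snd_conv])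
    (auto intro!: continuous_intros)

text \<open>Inversion is not continuous on the whole line, and the approximants of \<open>g\<close>
  may vanish even though \<open>g\<close> does not. They are therefore cut off from below by
  1/(n+1); this bound tends to 0, so the limit at each point is still
  \<open>g x > 0\<close>.\<close>

lemma baire_one_inverse:
  assumes "g \<in> baire_one" and pos: "\<And>x. g x > 0"
  shows "(\<lambda>x. inverse (g x)) \<in> baire_one"
proof -
  obtain h where h: "\<And>n. continuous_on UNIV (h n)" "\<And>x. (\<lambda>n. h n x) \<longlonglongrightarrow> g x"
    using assms(1) by (rule baire_oneE) blast
  have p: "max (h n x) (inverse (real (Suc n))) > 0" for n x
    by (simp add: less_max_iff_disj)
  show ?thesis
  proof (rule baire_oneI)
    show "continuous_on UNIV (\<lambda>x. inverse (max (h n x) (inverse (real (Suc n)))))" for n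
      using p [of n] by (intro continuous_intros h) (metis less_irrefl)
    have "(\<lambda>n. max (h n x) (inverse (real (Suc n)))) \<longlonglongrightarrow> max (g x) 0" for x
      by (intro tendsto_max h LIMSEQ_inverse_real_of_nat)
    then show "(\<lambda>n. inverse (max (h n x) (inverse (real (Suc n))))) \<longlonglongrightarrow> inverse (g x)" for x
      using pos [of x] tendsto_inverse [where a = "max (g x) 0", OF \<open>\<And>x. _ \<longlonglongrightarrow> max (g x) 0\<close>]
      by (simp add: max_absorb1 less_imp_le)
  qed
qed

lemma baire_one_prod:
  assumes "\<And>i. i \<in> A \<Longrightarrow> F i \<in> baire_one"
  shows "(\<lambda>x. \<Prod>i\<in>A. F i x) \<in> baire_one"
  using assms by (induction A rule: infinite_finite_induct)
    (auto intro: baire_one_const baire_one_mult)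

lemma baire_one_Max:
  assumes "finite A" "A \<noteq> {}" "\<And>i. i \<in> A \<Longrightarrow> F i \<in> baire_one"
  shows "(\<lambda>x. Max ((\<lambda>i. F i x) ` A)) \<in> baire_one"
  using assms
  by (induction A rule: finite_ne_induct) (auto intro: baire_one_max)

subsection \<open>Level sets\<close>

text \<open>An arbitrary countable index set allows families indexed by pairs of naturals, with no
  explicit coding of pairs. The empty intersection is the whole space.\<close>

lemma gdelta_countable_INT:
  fixes U :: "'i \<Rightarrow> 'a::topological_space set"
  assumes "countable I" "\<And>i. i \<in> I \<Longrightarrow> open (U i)"
  shows "gdelta (\<Inter>i\<in>I. U i)"
proof (cases "I = {}")
  case True
  then show ?thesis
    using gdelta.intros [of "\<lambda>n::nat. UNIV :: 'a set"] by simp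
next
  case False
  then have "(\<Inter>i\<in>I. U i) = (\<Inter>n. U (from_nat_into I n))"
    using range_from_nat_into [OF False assms(1)] by (metis image_image)
  then show ?thesis
    using gdelta.intros [of "\<lambda>n. U (from_nat_into I n)"] assms False
    by (simp add: from_nat_into)
qed

lemma gdelta_sigma_countable_UN:
  fixes A :: "'i \<Rightarrow> 'a::topological_space set"
  assumes "countable I" "I \<noteq> {}" "\<And>i. i \<in> I \<Longrightarrow> gdelta (A i)"
  shows "gdelta_sigma (\<Union>i\<in>I. A i)"
  unfolding gdelta_sigma_def
proof (intro exI conjI allI)
  show "gdelta (A (from_nat_into I n))" for n
    using assms by (simp add: from_nat_into)
  show "(\<Union>i\<in>I. A i) = (\<Union>n. A (from_nat_into I n))"
    using range_from_nat_into [OF assms(2,1)] by (metis image_image)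
qed

lemma gdelta_INT:
  fixes A :: "nat \<Rightarrow> 'a::topological_space set"
  assumes "\<And>n. gdelta (A n)"
  shows "gdelta (\<Inter>n. A n)"
proof -
  have "\<exists>U. (\<forall>k::nat. open (U k)) \<and> A n = (\<Inter>k. U k)" for n
    using assms [of n] by (auto elim!: gdelta.cases)
  then obtain U where U: "\<And>n k::nat. open (U n k)" "\<And>n. A n = (\<Inter>k. U n k)"
    by metis
  have "gdelta (\<Inter>p\<in>UNIV. case p of (n, k) \<Rightarrow> U n k)"
    by (rule gdelta_countable_INT) (auto simp: U)
  also have "(\<Inter>p\<in>UNIV. case p of (n, k) \<Rightarrow> U n k) = (\<Inter>n. A n)"
    by (auto simp: U)
  finally show ?thesis .
qed

lemma gdelta_sigma_UN:
  fixes A :: "nat \<Rightarrow> 'a::topological_space set"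
  assumes "\<And>n. gdelta_sigma (A n)"
  shows "gdelta_sigma (\<Union>n. A n)"
proof -
  have "\<exists>B. (\<forall>k::nat. gdelta (B k)) \<and> A n = (\<Union>k. B k)" for n
    using assms [of n] unfolding gdelta_sigma_def .
  then obtain B where B: "\<And>n k::nat. gdelta (B n k)" "\<And>n. A n = (\<Union>k. B n k)"
    by metis
  have "gdelta_sigma (\<Union>p\<in>UNIV. case p of (n, k) \<Rightarrow> B n k)"
    by (rule gdelta_sigma_countable_UN) (auto simp: B)
  also have "(\<Union>p\<in>UNIV. case p of (n, k) \<Rightarrow> B n k) = (\<Union>n. A n)"
    by (auto simp: B)
  finally show ?thesis .
qed

lemma gdelta_imp_gdelta_sigma: "gdelta C \<Longrightarrow> gdelta_sigma C"
  unfolding gdelta_sigma_def by (rule exI [of _ "\<lambda>n. C"]) auto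

text \<open>Since \<open>h n x\<close> converges to \<open>g x\<close>, the bound
  \<open>c \<le> g x\<close> holds iff for every \<open>k\<close> the value \<open>h n x\<close>
  exceeds c - 1/(k+1) for infinitely many \<open>n\<close>. "Infinitely many" reads "for all
  \<open>N\<close> some \<open>n \<ge> N\<close>", so only open sets and countable intersections
  occur.\<close>

lemma gdelta_baire_one_ge:
  assumes "g \<in> baire_one"
  shows "gdelta {x. c \<le> g x}"
proof -
  obtain h where h: "\<And>n. continuous_on UNIV (h n)" "\<And>x. (\<lambda>n. h n x) \<longlonglongrightarrow> g x"
    using assms by (rule baire_oneE) blast
  define U where "U = (\<lambda>(k::nat, N). \<Union>n\<in>{N..}. {x. c - inverse (real (Suc k)) < h n x})"
  have "open (U p)" for p
    unfolding U_def by (auto split: prod.split intro!: open_UN open_Collect_less h continuous_intros)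
  then have "gdelta (\<Inter>p\<in>UNIV. U p)"
    by (intro gdelta_countable_INT) auto
  also have "(\<Inter>p\<in>UNIV. U p) = {x. c \<le> g x}"
  proof (intro equalityI subsetI CollectI)
    fix x assume x: "x \<in> (\<Inter>p\<in>UNIV. U p)"
    show "c \<le> g x"
    proof (rule ccontr)
      assume "\<not> c \<le> g x"
      then obtain k where k: "inverse (real (Suc k)) < c - g x"
        using reals_Archimedean [of "c - g x"] by auto
      then have "g x < c - inverse (real (Suc k))"
        by linarith
      then have "eventually (\<lambda>n. h n x < c - inverse (real (Suc k))) sequentially"
        using order_tendstoD(2) [OF h(2) [of x]] by (simp del: of_nat_Suc)
      then obtain N where "\<And>n. n \<ge> N \<Longrightarrow> h n x < c - inverse (real (Suc k))"
        unfolding eventually_sequentially by blast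
      moreover have "x \<in> U (k, N)"
        using x by blast
      ultimately show False
        unfolding U_def by (fastforce dest: less_asym)
    qed
  next
    fix x assume "x \<in> {x. c \<le> g x}"
    show "x \<in> (\<Inter>p\<in>UNIV. U p)"
    proof (clarify)
      fix k N :: nat
      have "c - inverse (real (Suc k)) < g x"
        using \<open>x \<in> {x. c \<le> g x}\<close> positive_imp_inverse_positive [of "real (Suc k)"]
        by (simp del: inverse_positive_iff_positive)
      then have "eventually (\<lambda>n. c - inverse (real (Suc k)) < h n x) sequentially"
        using order_tendstoD(1) [OF h(2)] by simp
      then obtain M where "\<And>n. n \<ge> M \<Longrightarrow> c - inverse (real (Suc k)) < h n x"
        unfolding eventually_sequentially by blast
      then have "c - inverse (real (Suc k)) < h (max M N) x"
        by simp
      then show "x \<in> U (k, N)"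
        unfolding U_def by (auto intro!: bexI [of _ "max M N"])
    qed
  qed
  finally show ?thesis .
qed

text \<open>A strict inequality at the limit amounts to a uniform margin 1/(k+1) from some index
  \<open>N\<close> on. For fixed \<open>k\<close> and \<open>N\<close> this is a countable
  intersection of non-strict level sets of Baire one functions.\<close>

lemma gdelta_sigma_baire_two_greater:
  assumes "g \<in> baire_two"
  shows "gdelta_sigma {x. a < g x}"
proof -
  obtain h where h: "\<And>n. h n \<in> baire_one" "\<And>x. (\<lambda>n. h n x) \<longlonglongrightarrow> g x"
    using assms by (rule baire_twoE) blast
  define B where
    "B = (\<lambda>(k::nat, N::nat). \<Inter>n. {x. a + inverse (real (Suc k)) \<le> h (n + N) x})"
  have "gdelta (B p)" for p
    unfolding B_def by (auto split: prod.split intro!: gdelta_INT gdelta_baire_one_ge h)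
  then have "gdelta_sigma (\<Union>p\<in>UNIV. B p)"
    by (intro gdelta_sigma_countable_UN) auto
  also have "(\<Union>p\<in>UNIV. B p) = {x. a < g x}"
  proof (intro equalityI subsetI CollectI)
    fix x assume "x \<in> (\<Union>p\<in>UNIV. B p)"
    then obtain k N where "\<And>n. a + inverse (real (Suc k)) \<le> h (n + N) x"
      unfolding B_def by auto
    moreover have "(\<lambda>n. h (n + N) x) \<longlonglongrightarrow> g x"
      using h(2) by (rule LIMSEQ_ignore_initial_segment)
    ultimately have "a + inverse (real (Suc k)) \<le> g x"
      by (intro LIMSEQ_le_const) auto
    then show "a < g x"
      using positive_imp_inverse_positive [of "real (Suc k)"] by linarith
  next
    fix x assume "x \<in> {x. a < g x}"
    then obtain k where "inverse (real (Suc k)) < g x - a"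
      using reals_Archimedean [of "g x - a"] by auto
    then have "eventually (\<lambda>n. a + inverse (real (Suc k)) < h n x) sequentially"
      using order_tendstoD(1) [OF h(2)] by (simp add: algebra_simps)
    then obtain N where "\<And>n. n \<ge> N \<Longrightarrow> a + inverse (real (Suc k)) < h n x"
      unfolding eventually_sequentially by blast
    then have "x \<in> B (k, N)"
      unfolding B_def by (auto simp: less_imp_le)
    then show "x \<in> (\<Union>p\<in>UNIV. B p)"
      by blast
  qed
  finally show ?thesis .
qed

lemma baire_two_uminus:
  assumes "g \<in> baire_two"
  shows "(\<lambda>x. - g x) \<in> baire_two"
proof -
  obtain h where h: "\<And>n. h n \<in> baire_one" "\<And>x. (\<lambda>n. h n x) \<longlonglongrightarrow> g x"
    using assms by (rule baire_twoE) blast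
  have "(\<lambda>x. - h n x) \<in> baire_one" for n
    using baire_one_diff [OF baire_one_const [of 0] h(1) [of n]] by simp
  then show ?thesis
    by (rule baire_twoI [where h = "\<lambda>n x. - h n x"]) (intro tendsto_minus h)
qed

lemma gdelta_sigma_baire_two_less:
  assumes "g \<in> baire_two"
  shows "gdelta_sigma {x. g x < a}"
  using gdelta_sigma_baire_two_greater [OF baire_two_uminus [OF assms], of "- a"] by simp

subsection \<open>Zero sets of Baire one functions\<close>

text \<open>For \<open>r > 0\<close> the sequence is eventually 0, for \<open>r = 0\<close> it is
  constantly 1. It serves with \<open>r\<close> a distance to a closed set, and with
  \<open>r\<close> a value of a nonnegative Baire one function.\<close>

lemma tendsto_max_one_minus_mult:
  fixes r :: real
  assumes "0 \<le> r"
  shows "(\<lambda>n. max 0 (1 - real n * r)) \<longlonglongrightarrow> of_bool (r = 0)"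
proof (cases "r = 0")
  case False
  with assms have pos: "r > 0"
    by simp
  obtain N :: nat where N: "1 < real N * r"
    using ex_less_of_nat_mult [OF pos] by blast
  have "max 0 (1 - real n * r) = 0" if "n \<ge> N" for n
  proof -
    have "real N * r \<le> real n * r"
      using that pos by (intro mult_right_mono) auto
    then show ?thesis
      using N by simp
  qed
  then have "eventually (\<lambda>n. max 0 (1 - real n * r) = 0) sequentially"
    unfolding eventually_sequentially by blast
  then show ?thesis
    using False by (simp add: tendsto_eventually)
qed simp

lemma closed_indicator_approx:
  fixes C :: "real set"
  assumes "closed C"
  obtains \<phi> :: "nat \<Rightarrow> real \<Rightarrow> real" where
    "\<And>m. continuous_on UNIV (\<phi> m)" "\<And>m x. 0 \<le> \<phi> m x" "\<And>m x. \<phi> m x \<le> 1"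
    "\<And>x. (\<lambda>m. \<phi> m x) \<longlonglongrightarrow> indicator C x"
\<comment> \<open>By convention \<open>infdist x {} = 0\<close>, so the distance formula would give
  the constant 1 for the empty set.\<close>
proof (cases "C = {}")
  case True
  then show ?thesis
    by (intro that [of "\<lambda>m x. 0"]) auto
next
  case False
  show ?thesis
  proof (rule that [of "\<lambda>m x. max 0 (1 - real m * infdist x C)"])
    show "continuous_on UNIV (\<lambda>x. max 0 (1 - real m * infdist x C))" for m
      by (intro continuous_intros)
    show "(\<lambda>m. max 0 (1 - real m * infdist x C)) \<longlonglongrightarrow> indicator C x" for x
      using tendsto_max_one_minus_mult [OF infdist_nonneg [of x C]]
      by (simp add: in_closed_iff_infdist_zero [OF assms False] indicator_def)
  qed (auto simp: infdist_nonneg)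
qed

text \<open>For \<open>C\<close> the intersection of open sets \<open>U k\<close>, the sum over
  \<open>k\<close> of (1/2)^k times the indicator of \<open>- U k\<close> vanishes exactly where
  every term does, that is, on \<open>C\<close>.\<close>

lemma gdelta_zero_set:
  fixes C :: "real set"
  assumes "gdelta C"
  obtains a where "a \<in> baire_one" "\<And>x. 0 \<le> a x" "\<And>x. a x = 0 \<longleftrightarrow> x \<in> C"
proof -
  obtain U :: "nat \<Rightarrow> real set" where U: "\<And>k. open (U k)" "C = (\<Inter>k. U k)"
    using assms by (auto elim!: gdelta.cases)
  have "\<exists>\<phi>. (\<forall>m. continuous_on UNIV (\<phi> m)) \<and> (\<forall>m x. 0 \<le> \<phi> m x \<and> \<phi> m x \<le> 1) \<and>
        (\<forall>x. (\<lambda>m. \<phi> m x) \<longlonglongrightarrow> (indicator (- U k) x :: real))" for k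
    using closed_indicator_approx [of "- U k"] U(1) [of k, THEN closed_Compl] by metis
  then obtain \<phi> :: "nat \<Rightarrow> nat \<Rightarrow> real \<Rightarrow> real" where
    \<phi>: "\<And>k m. continuous_on UNIV (\<phi> k m)" "\<And>k m x. 0 \<le> \<phi> k m x" "\<And>k m x. \<phi> k m x \<le> 1"
      "\<And>k x. (\<lambda>m. \<phi> k m x) \<longlonglongrightarrow> indicator (- U k) x"
    by metis
  define t where "t = (\<lambda>x k. (1/2)^k * (indicator (- U k) x :: real))"
  have t_nonneg: "0 \<le> t x k" for x k
    by (simp add: t_def)
  have geo: "summable (\<lambda>k. (1/2 :: real)^k)"
    by (intro summable_geometric) auto
  have summ: "summable (t x)" for x
    by (rule summable_comparison_test' [OF geo, of 0]) (auto simp: t_def indicator_def)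
  show ?thesis
  proof (rule that [of "\<lambda>x. suminf (t x)"])
    show "(\<lambda>x. suminf (t x)) \<in> baire_one"
    proof (rule baire_oneI)
      \<comment> \<open>Diagonal choice: the same \<open>m\<close> truncates the series and selects
        the approximant of each indicator.\<close>
      show "continuous_on UNIV (\<lambda>x. \<Sum>k<m. (1/2)^k * \<phi> k m x)" for m
        by (intro continuous_intros \<phi>)
      fix x
      \<comment> \<open>Padding with zeros turns the partial sum into a series dominated by (1/2)^k
        uniformly in \<open>m\<close>, so Tannery's theorem lets the limit pass under the
        sum.\<close>
      have "(\<lambda>m. suminf (\<lambda>k. if k < m then (1/2)^k * \<phi> k m x else 0)) \<longlonglongrightarrow> suminf (t x)"
      proof (rule conjunct2 [OF conjunct2 [OF tannerys_theorem [OF _ _ geo]]])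
        fix k
        have "(\<lambda>m. (1/2)^k * \<phi> k m x) \<longlonglongrightarrow> t x k"
          unfolding t_def by (intro tendsto_intros \<phi>)
        moreover have "eventually (\<lambda>m. (1/2)^k * \<phi> k m x
            = (if k < m then (1/2)^k * \<phi> k m x else 0)) sequentially"
          using eventually_gt_at_top [of k] by eventually_elim auto
        ultimately show "(\<lambda>m. if k < m then (1/2)^k * \<phi> k m x else 0) \<longlonglongrightarrow> t x k"
          by (rule Lim_transform_eventually)
      next
        show "eventually (\<lambda>(k, m). norm (if k < m then (1/2)^k * \<phi> k m x else 0) \<le> (1/2)^k)
            (at_top \<times>\<^sub>F sequentially)"
          using \<phi>(2,3) by (intro always_eventually) (auto simp: abs_mult)
      qed auto
      moreover have "suminf (\<lambda>k. if k < m then (1/2)^k * \<phi> k m x else 0)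
          = (\<Sum>k<m. (1/2)^k * \<phi> k m x)" for m
        by (subst suminf_finite [of "{..<m}"]) auto
      ultimately show "(\<lambda>m. \<Sum>k<m. (1/2)^k * \<phi> k m x) \<longlonglongrightarrow> suminf (t x)"
        by simp
    qed
    show "0 \<le> suminf (t x)" for x
      by (intro suminf_nonneg summ t_nonneg)
    show "suminf (t x) = 0 \<longleftrightarrow> x \<in> C" for x
      by (subst suminf_eq_zero_iff [OF summ t_nonneg]) (auto simp: t_def U indicator_def)
  qed
qed

lemma gdelta_sigma_zero_sets:
  fixes S :: "real set"
  assumes "gdelta_sigma S"
  obtains \<zeta> :: "nat \<Rightarrow> real \<Rightarrow> real"
  where "\<And>j. \<zeta> j \<in> baire_one" "\<And>j x. 0 \<le> \<zeta> j x" "\<And>x. (\<exists>j. \<zeta> j x = 0) \<longleftrightarrow> x \<in> S"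
proof -
  obtain A :: "nat \<Rightarrow> real set" where A: "\<And>j. gdelta (A j)" "S = (\<Union>j. A j)"
    using assms unfolding gdelta_sigma_def by blast
  have "\<exists>a. a \<in> baire_one \<and> (\<forall>x. 0 \<le> a x \<and> (a x = 0 \<longleftrightarrow> x \<in> A j))" for j
    by (rule gdelta_zero_set [OF A(1)]) blast
  then obtain \<zeta> where "\<And>j. \<zeta> j \<in> baire_one" "\<And>j x. 0 \<le> \<zeta> j x \<and> (\<zeta> j x = 0 \<longleftrightarrow> x \<in> A j)"
    by metis
  then show ?thesis
    using that [of \<zeta>] A(2) by blast
qed

lemma baire_two_indicator_gdelta:
  fixes C :: "real set"
  assumes "gdelta C"
  shows "indicator C \<in> baire_two"
proof -
  obtain a where a: "a \<in> baire_one" "\<And>x. 0 \<le> a x" "\<And>x. a x = 0 \<longleftrightarrow> x \<in> C"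
    using gdelta_zero_set [OF assms] by blast
  show ?thesis
  proof (rule baire_twoI)
    show "(\<lambda>x. max 0 (1 - real n * a x)) \<in> baire_one" for n
      by (intro baire_one_max baire_one_diff baire_one_mult baire_one_const a)
    show "(\<lambda>n. max 0 (1 - real n * a x)) \<longlonglongrightarrow> indicator C x" for x
      using tendsto_max_one_minus_mult [OF a(2) [of x]] by (simp add: a(3) indicator_def)
  qed
qed

subsection \<open>The Lebesgue--Hausdorff theorem\<close>

text \<open>Stage \<open>n\<close> uses only the first n+1 rationals and the first n+1 pieces of
  each level set. The lower bound on the limit needs one good index; the upper bound must control
  all indices of the maximum at once.\<close>

lemma baire_two_level_sets:
  fixes g :: "real \<Rightarrow> real"
  assumes gt: "\<And>a. gdelta_sigma {x. a < g x}" and lt: "\<And>a. gdelta_sigma {x. g x < a}"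
  shows "g \<in> baire_two"
proof -
  obtain q :: "nat \<Rightarrow> real" where q: "range q = \<rat>"
    using Rats_eq_range_of_rat_o_nat_to_rat_surj by metis
  have dense: "\<exists>i. a < q i \<and> q i < b" if "a < b" for a b :: real
    using Rats_dense_in_real [OF that] q by (metis imageE)
  have "\<exists>\<zeta>. (\<forall>j::nat. \<zeta> j \<in> baire_one) \<and> (\<forall>j x. 0 \<le> \<zeta> j x) \<and>
        (\<forall>x. (\<exists>j. \<zeta> j x = 0) \<longleftrightarrow> q i < g x)" for i
    by (rule gdelta_sigma_zero_sets [OF gt [of "q i"]]) auto
  then obtain \<zeta> where \<zeta>: "\<And>i j. \<zeta> i j \<in> baire_one" "\<And>i (j::nat) x. 0 \<le> \<zeta> i j x"
      "\<And>i x. (\<exists>j. \<zeta> i j x = 0) \<longleftrightarrow> q i < g x"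
    by metis
  have "\<exists>\<omega>. (\<forall>j::nat. \<omega> j \<in> baire_one) \<and> (\<forall>j x. 0 \<le> \<omega> j x) \<and>
        (\<forall>x. (\<exists>j. \<omega> j x = 0) \<longleftrightarrow> g x < q i)" for i
    by (rule gdelta_sigma_zero_sets [OF lt [of "q i"]]) auto
  then obtain \<omega> where \<omega>: "\<And>i j. \<omega> i j \<in> baire_one" "\<And>i (j::nat) x. 0 \<le> \<omega> i j x"
      "\<And>i x. (\<exists>j. \<omega> i j x = 0) \<longleftrightarrow> g x < q i"
    by metis
  \<comment> \<open>A product of zero-set functions vanishes on the union of the zero sets, here the
    part of \<open>{x. q i < g x}\<close> exhausted by stage \<open>n\<close>.\<close>
  define z where "z = (\<lambda>n i x. \<Prod>j\<le>n. \<zeta> i j x)"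
  \<comment> \<open>The product also runs over all \<open>q i' \<le> q i\<close>, so that a zero of \<open>w n i'\<close> forces a zero of
    \<open>w n i\<close> for every larger \<open>q i\<close>.\<close>
  define w where "w = (\<lambda>n i x. \<Prod>i'\<in>{i'. i' \<le> n \<and> q i' \<le> q i}. \<Prod>j\<le>n. \<omega> i' j x)"
  have z1: "z n i \<in> baire_one" and w1: "w n i \<in> baire_one" for n i
    unfolding z_def w_def by (intro baire_one_prod \<zeta> \<omega>)+
  have z0: "0 \<le> z n i x" and w0: "0 \<le> w n i x" for n i x
    unfolding z_def w_def by (intro prod_nonneg ballI \<zeta> \<omega>)+
  have z_iff: "z n i x = 0 \<longleftrightarrow> (\<exists>j\<le>n. \<zeta> i j x = 0)" for n i x
    unfolding z_def by auto
  have w_iff: "w n i x = 0 \<longleftrightarrow> (\<exists>i'\<le>n. q i' \<le> q i \<and> (\<exists>j\<le>n. \<omega> i' j x = 0))" for n i x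
    unfolding w_def by auto
  have wz: "0 < w n i x + z n i x" for n i x
  proof -
    \<comment> \<open>A zero of \<open>w\<close> gives \<open>g x < q i'\<close> for some
      \<open>q i' \<le> q i\<close>, while a zero of \<open>z\<close> gives
      \<open>q i < g x\<close>.\<close>
    have "\<not> (w n i x = 0 \<and> z n i x = 0)"
      unfolding w_iff z_iff using \<zeta>(3) \<omega>(3) by (metis less_le_trans not_less_iff_gr_or_eq)
    then show ?thesis
      using z0 [of n i x] w0 [of n i x] by linarith
  qed
  define u where "u = (\<lambda>n i x. w n i x * inverse (w n i x + z n i x))"
  have u1: "u n i \<in> baire_one" for n i
    unfolding u_def by (intro baire_one_mult baire_one_inverse baire_one_add w1 z1 wz)
  have u_range: "0 \<le> u n i x" "u n i x \<le> 1" for n i x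
    using wz [of n i x] w0 [of n i x] z0 [of n i x] unfolding u_def
    by (auto simp: field_simps)
  have u_z: "u n i x = 1" if "z n i x = 0" for n i x
    using wz [of n i x] that unfolding u_def by simp
  have u_w: "u n i x = 0" if "w n i x = 0" for n i x
    using that unfolding u_def by simp
  \<comment> \<open>This interpolates between \<open>q i\<close>, where \<open>g x > q i\<close> is
    already detected, and \<open>- real n\<close>, where \<open>g x < q i\<close> is. The value
    \<open>- real n\<close> eventually lies below any given bound, so rejected indices do not raise
    the maximum.\<close>
  define v where "v = (\<lambda>n i x. u n i x * q i + (1 - u n i x) * - real n)"
  define h where "h = (\<lambda>n x. Max ((\<lambda>i. v n i x) ` {..n}))"
  show ?thesis
  proof (rule baire_twoI)
    show "h n \<in> baire_one" for n
      unfolding h_def v_def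
      by (intro baire_one_Max baire_one_add baire_one_mult baire_one_diff baire_one_const u1) auto
    show "(\<lambda>n. h n x) \<longlonglongrightarrow> g x" for x
    proof (rule order_tendstoI)
      fix a assume "a < g x"
      then obtain i where i: "a < q i" "q i < g x"
        using dense by blast
      then obtain j where j: "\<zeta> i j x = 0"
        using \<zeta>(3) by blast
      have "a < h n x" if "n \<ge> max i j" for n
      proof -
        have "z n i x = 0"
          using j that by (auto simp: z_iff)
        then have "v n i x = q i"
          by (simp add: v_def u_z)
        moreover have "v n i x \<le> h n x"
          unfolding h_def using that by (intro Max_ge) auto
        ultimately show ?thesis
          using i by simp
      qed
      then show "eventually (\<lambda>n. a < h n x) sequentially"
        unfolding eventually_sequentially by blast
    next
      fix a assume "g x < a"
      then obtain i where i: "g x < q i" "q i < a"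
        using dense by blast
      then obtain j where j: "\<omega> i j x = 0"
        using \<omega>(3) by blast
      obtain N :: nat where N: "- q i \<le> real N"
        using real_arch_simple by blast
      have "h n x < a" if "n \<ge> max N (max i j)" for n
      proof -
        have nq: "- real n \<le> q i"
          using N that by linarith
        \<comment> \<open>If \<open>q i \<le> q k\<close>, the zero of \<open>\<omega> i j\<close>
          is also a zero of \<open>w n k\<close>, so \<open>v n k x\<close> is
          \<open>- real n\<close>. Otherwise both endpoints of the interpolation are at most
          \<open>q i\<close>, whatever the weight.\<close>
        have "v n k x \<le> q i" for k
        proof (cases "q i \<le> q k")
          case True
          then have "w n k x = 0"
            using j that unfolding w_iff by auto
          then show ?thesis
            using nq by (simp add: v_def u_w)
        next
          case False
          then show ?thesis
            unfolding v_def using nq u_range [of n k x]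
            by (intro convex_bound_le) auto
        qed
        then have "h n x \<le> q i"
          unfolding h_def by (subst Max_le_iff) auto
        then show ?thesis
          using i by simp
      qed
      then show "eventually (\<lambda>n. h n x < a) sequentially"
        unfolding eventually_sequentially by blast
    qed
  qed
qed

section \<open>Preimages and the compositor condition\<close>

text \<open>Preimages commute with unions, and countable unions of G-delta-sigma sets are again of
  this kind.\<close>

lemma gdelta_sigma_vimage_if_gdelta:
  fixes f :: "'a::topological_space \<Rightarrow> 'b::topological_space"
  assumes "\<And>C. gdelta C \<Longrightarrow> gdelta_sigma (f -` C)" "gdelta_sigma C"
  shows "gdelta_sigma (f -` C)"
proof -
  obtain A :: "nat \<Rightarrow> 'b set" where A: "\<And>n. gdelta (A n)" "C = (\<Union>n. A n)"
    using assms(2) unfolding gdelta_sigma_def by blast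
  show ?thesis
    unfolding A(2) vimage_UN by (rule gdelta_sigma_UN) (rule assms(1) [OF A(1)])
qed

theorem theorem4p0p18:
  fixes f :: "real \<Rightarrow> real"
  shows "((\<forall>C. gdelta C \<longrightarrow> gdelta_sigma (f -` C)) \<longleftrightarrow>
          (\<forall>C. gdelta_sigma C \<longrightarrow> gdelta_sigma (f -` C))) \<and>
         ((\<forall>C. gdelta_sigma C \<longrightarrow> gdelta_sigma (f -` C)) \<longleftrightarrow>
          right_baire_two_compositor f)"
proof -
  have 12: "\<forall>C. gdelta_sigma C \<longrightarrow> gdelta_sigma (f -` C)"
    if "\<forall>C. gdelta C \<longrightarrow> gdelta_sigma (f -` C)"
    using that gdelta_sigma_vimage_if_gdelta by blast
  have 21: "\<forall>C. gdelta C \<longrightarrow> gdelta_sigma (f -` C)"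
    if "\<forall>C. gdelta_sigma C \<longrightarrow> gdelta_sigma (f -` C)"
    using that gdelta_imp_gdelta_sigma by blast
  have 23: "right_baire_two_compositor f"
    if pre: "\<forall>C. gdelta_sigma C \<longrightarrow> gdelta_sigma (f -` C)"
  proof -
    have "g \<circ> f \<in> baire_two" if g: "g \<in> baire_two" for g
    proof (rule baire_two_level_sets)
      show "gdelta_sigma {x. a < (g \<circ> f) x}" for a
        using pre [rule_format, OF gdelta_sigma_baire_two_greater [OF g, of a]]
        by (simp add: vimage_def)
      show "gdelta_sigma {x. (g \<circ> f) x < a}" for a
        using pre [rule_format, OF gdelta_sigma_baire_two_less [OF g, of a]]
        by (simp add: vimage_def)
    qed
    then show ?thesis
      unfolding right_baire_two_compositor_def composition_operator_def by blast
  qed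
  have 31: "gdelta_sigma (f -` C)" if "right_baire_two_compositor f" "gdelta C" for C
  proof -
    have "(indicator C :: real \<Rightarrow> real) \<circ> f \<in> baire_two"
      using that baire_two_indicator_gdelta
      unfolding right_baire_two_compositor_def composition_operator_def by blast
    then have "gdelta_sigma {x. 0 < ((indicator C :: real \<Rightarrow> real) \<circ> f) x}"
      by (rule gdelta_sigma_baire_two_greater)
    also have "{x. 0 < ((indicator C :: real \<Rightarrow> real) \<circ> f) x} = f -` C"
      by (auto simp: indicator_def)
    finally show ?thesis .
  qed
  show ?thesis
    using 12 21 23 31 by blast
qed

end
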